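(* Let $m\ge1$, $0=t_1<t_2<\dots<t_{m+1}$, $d_k=t_{k+1}-t_k$ for $k=1,\dots,m$, and let $\mathbf z(t)=\sum_{i=0}^m\mathbf z_iN^1_{i,\mu}(t)$, $\mathbf z_i\in\mathbb C$, over $\mu=\{\langle0\rangle^2<t_2<\dots<t_m<\langle t_{m+1}\rangle^2\}$. Let $\nu=\{\langle0\rangle^3<\langle t_2\rangle^2<\dots<\langle t_m\rangle^2<\langle t_{m+1}\rangle^3\}$ and $\rho=\{\langle0\rangle^4<\langle t_2\rangle^2<\dots<\langle t_m\rangle^2<\langle t_{m+1}\rangle^4\}$. Then $\mathbf z^2(t)=\sum_{k=0}^{2m}\mathbf p_kN^2_{k,\nu}(t)$ with $$\mathbf p_{2k}=\mathbf z_k^2\ (0\le k\le m),\qquad \mathbf p_{2k+1}=\mathbf z_k\mathbf z_{k+1}\ (0\le k\le m-1),$$ and $|\mathbf z(t)|^2=\sum_{k=0}^{2m}\sigma_kN^2_{k,\nu}(t)$ with $$\sigma_{2k}=\mathbf z_k\bar{\mathbf z}_k\ (0\le k\le m),\qquad \sigma_{2k+1}=\tfrac12(\mathbf z_k\bar{\mathbf z}_{k+1}+\mathbf z_{k+1}\bar{\mathbf z}_k)\ (0\le k\le m-1).$$ The clamped cubic Pythagorean-Hodograph B-spline curve $\mathbf r(t)$, $t\in[t_1,t_{m+1}]$, with $\mathbf r'=\mathbf z^2$ is $\mathbf r(t)=\sum_{i=0}^{2m+1}\mathbf r_iN^3_{i,\rho}(t)$ with $\mathbf r_0$ arbitrary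 and $$\mathbf r_1=\mathbf r_0+\tfrac{d_1}3\mathbf z_0^2,\qquad \mathbf r_{2i+2}=\mathbf r_{2i+1}+\tfrac{d_{i+1}}3\mathbf z_i\mathbf z_{i+1}\ (0\le i\le m-1),$$ $$\mathbf r_{2i+3}=\mathbf r_{2i+2}+\tfrac{d_{i+1}+d_{i+2}}3\mathbf z_{i+1}^2\ (0\le i\le m-2),\qquad \mathbf r_{2m+1}=\mathbf r_{2m}+\tfrac{d_m}3\mathbf z_m^2.$$ Its total arc length is $L=l_{2m+1}$, where $l_0=0$, $l_1=l_0+\frac{d_1}3\mathbf z_0\bar{\mathbf z}_0$, $l_{2i+2}=l_{2i+1}+\frac{d_{i+1}}6(\mathbf z_i\bar{\mathbf z}_{i+1}+\mathbf z_{i+1}\bar{\mathbf z}_i)$ for $0\le i\le m-1$, $l_{2i+3}=l_{2i+2}+\frac{d_{i+1}+d_{i+2}}3\mathbf z_{i+1}\bar{\mathbf z}_{i+1}$ for $0\le i\le m-2$, and $l_{2m+1}=l_{2m}+\frac{d_m}3\mathbf z_m\bar{\mathbf z}_m$.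
   Context: Normalized B-splines: for a nondecreasing knot sequence $\mu=\{t_i\}$, $N^0_{i,\mu}(t)=1$ if $t\in[t_i,t_{i+1})$ and $0$ otherwise, and $N^n_{i,\mu}(t)=\frac{t-t_i}{t_{i+n}-t_i}N^{n-1}_{i,\mu}(t)+\frac{t_{i+n+1}-t}{t_{i+n+1}-t_{i+1}}N^{n-1}_{i+1,\mu}(t)$ with $0/0=0$. Basis functions are indexed by the position (starting at $0$) of their first knot in the partition. $\langle t\rangle^k$ denotes the knot $t$ repeated $k$ times. At the right end of the domain, values are left limits. Points of $\mathbb R^2$ are identified with complex numbers. *)

theory Defs
  imports "HOL-Analysis.Analysis"
begin

text \<open>
  Knot sequences are lists and the basis function with index \<open>i\<close> starts at the knot \<open>T ! i\<close>.
  The convention \<open>0/0 = 0\<close> is the library's \<open>x / 0 = 0\<close>: a denominator only vanishes when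
  the lower-degree basis function it is multiplied with is identically zero.
\<close>

fun bspline_rec :: "real list \<Rightarrow> nat \<Rightarrow> nat \<Rightarrow> real \<Rightarrow> real" where
  "bspline_rec T 0 i s = (if T ! i \<le> s \<and> s < T ! (i + 1) then 1 else 0)"
| "bspline_rec T (Suc n) i s =
     (s - T ! i) / (T ! (i + Suc n) - T ! i) * bspline_rec T n i s
     + (T ! (i + Suc n + 1) - s) / (T ! (i + Suc n + 1) - T ! (i + 1)) * bspline_rec T n (i + 1) s"

text \<open>
  The half-open intervals above make every basis function vanish at the last knot, which for the
  clamped sequences below is the right end of the domain; there the value is the left limit.
\<close>

definition bspline :: "real list \<Rightarrow> nat \<Rightarrow> nat \<Rightarrow> real \<Rightarrow> real" where
  "bspline T n i s =
     (if s = last T then Lim (at_left s) (bspline_rec T n i) else bspline_rec T n i s)"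

text \<open>Breakpoints \<open>t 1, \<dots>, t (m + 1)\<close>; end knots have multiplicity \<open>a\<close>, interior knots \<open>b\<close>.\<close>

definition clamped_knots :: "(nat \<Rightarrow> real) \<Rightarrow> nat \<Rightarrow> nat \<Rightarrow> nat \<Rightarrow> real list" where
  "clamped_knots t m a b =
     replicate a (t 1) @ concat (map (\<lambda>k. replicate b (t k)) [2..<m + 1]) @ replicate a (t (m + 1))"

definition has_arc_length :: "(real \<Rightarrow> complex) \<Rightarrow> real \<Rightarrow> real \<Rightarrow> real \<Rightarrow> bool" where
  "has_arc_length r a b L \<longleftrightarrow>
     ((\<lambda>s. norm (vector_derivative r (at s within {a..b}))) has_integral L) {a..b}"

end

theory Submission
  imports Defs
begin

text \<open>
  On the knot span \<open>[t (k + 1), t (k + 2)]\<close> of length \<open>h\<close>, with \<open>u = (s - t (k + 1)) / h\<close>, the linear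
  spline is \<open>(1 - u) z\<^sub>k + u z\<^sub>k\<^sub>+\<^sub>1\<close>, and because the interior knots of \<open>\<nu>\<close> are double, the quadratic
  basis functions are the Bernstein polynomials \<open>(1 - u)\<^sup>2, 2u(1 - u), u\<^sup>2\<close>; multiplying out gives the
  coefficients of \<open>z\<^sup>2\<close> and \<open>\<bar>z\<bar>\<^sup>2\<close>. If the coefficients of a cubic spline over \<open>\<rho>\<close> satisfy the
  recursion driven by quadratic coefficients \<open>C\<close>, then on this span it equals
  \<open>c\<^sub>2\<^sub>k\<^sub>+\<^sub>1 - h/3 (1 - u)\<^sup>3 C\<^sub>2\<^sub>k + h/3 (3u\<^sup>2 - 2u\<^sup>3) C\<^sub>2\<^sub>k\<^sub>+\<^sub>1 + h/3 u\<^sup>3 C\<^sub>2\<^sub>k\<^sub>+\<^sub>2\<close>, whose derivative is the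
  quadratic spline with coefficients \<open>C\<close>. Gluing the spans gives the primitive of \<open>z\<^sup>2\<close>; applied to
  \<open>\<bar>z\<bar>\<^sup>2 = \<bar>r'\<bar>\<close> and evaluated at both ends it gives the arc length.
\<close>

section \<open>Polynomial pieces of B-splines\<close>

text \<open>
  The polynomial that the basis function agrees with on the span \<open>[T ! q, T ! (q + 1))\<close>. It is
  continuous on the whole line, so its value at the last knot is the left limit.
\<close>

fun bspline_piece :: "real list \<Rightarrow> nat \<Rightarrow> nat \<Rightarrow> nat \<Rightarrow> real \<Rightarrow> real" where
  "bspline_piece T q 0 i s = (if i = q then 1 else 0)"
| "bspline_piece T q (Suc n) i s =
     (s - T ! i) / (T ! (i + Suc n) - T ! i) * bspline_piece T q n i s
     + (T ! (i + Suc n + 1) - s) / (T ! (i + Suc n + 1) - T ! (i + 1)) * bspline_piece T q n (i + 1) s"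

text \<open>Every degree step widens the support by one span to the right. This is what cuts the
  spline sums below to \<open>n + 1\<close> terms.\<close>

lemma bspline_piece_eq_0: "q < i \<or> i + n < q \<Longrightarrow> bspline_piece T q n i s = 0"
  by (induction n arbitrary: i) auto

lemma continuous_bspline_piece [continuous_intros]: "continuous_on A (bspline_piece T q n i)"
proof (induction n arbitrary: i)
  case 0
  then show ?case by (cases "i = q") simp_all
next
  case (Suc n)
  show ?case
    unfolding bspline_piece.simps divide_inverse by (intro continuous_intros Suc)
qed

text \<open>Both recursions have the same step, so only degree 0 matters: by sortedness, no
  half-open span other than number \<open>q\<close> contains \<open>s\<close>.\<close>

lemma bspline_rec_eq_piece:
  assumes "sorted T" "Suc q < length T" "T ! q \<le> s" "s < T ! Suc q" "i + n + 1 < length T"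
  shows "bspline_rec T n i s = bspline_piece T q n i s"
  using assms(5)
proof (induction n arbitrary: i)
  case 0
  have "T ! Suc i \<le> T ! q" if "i < q"
    using that assms by (intro sorted_nth_mono) auto
  moreover have "T ! Suc q \<le> T ! i" if "q < i"
    using that assms 0 by (intro sorted_nth_mono) auto
  ultimately show ?case using assms by (cases i q rule: linorder_cases) auto
next
  case (Suc n)
  then show ?case by simp
qed

lemma bspline_eq_piece:
  assumes "sorted T" "Suc q < length T" "i + n + 1 < length T"
    and "T ! q \<le> s" "s < T ! Suc q \<or> s = T ! Suc q \<and> s = last T \<and> T ! q < s"
  shows "bspline T n i s = bspline_piece T q n i s"
proof (cases "s = last T")
  case True
  \<comment> \<open>This rules out \<open>s < T ! Suc q\<close>, so \<open>s\<close> is the right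
    end of span \<open>q\<close>.\<close>
  have "T ! Suc q \<le> last T"
    using assms(1,2) sorted_nth_mono[of T "Suc q" "length T - 1"] 
    by (cases "T = []") (auto simp: last_conv_nth)
  with True assms have s: "s = T ! Suc q" "T ! q < s" by auto
  have "((bspline_piece T q n i) \<longlongrightarrow> bspline_piece T q n i s) (at_left s)"
    using continuous_bspline_piece[of UNIV T q n i]
    by (auto simp: continuous_on_def intro: tendsto_within_subset)
  \<comment> \<open>Since \<open>T ! q < s\<close>, points slightly to the left of \<open>s\<close>
    lie in span \<open>q\<close>.\<close>
  moreover have "eventually (\<lambda>x. bspline_piece T q n i x = bspline_rec T n i x) (at_left s)"
    using eventually_at_left_real[OF s(2)]
    by eventually_elim (use assms s in \<open>auto intro!: bspline_rec_eq_piece[symmetric]\<close>)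
  ultimately have "((bspline_rec T n i) \<longlongrightarrow> bspline_piece T q n i s) (at_left s)"
    by (blast intro: Lim_transform_eventually)
  then have "Lim (at_left s) (bspline_rec T n i) = bspline_piece T q n i s"
    by (intro tendsto_Lim) auto
  with True show ?thesis by (simp add: bspline_def)
next
  case False
  with assms show ?thesis by (auto simp: bspline_def intro: bspline_rec_eq_piece)
qed

text \<open>The knots \<open>T ! q\<close> and \<open>T ! (q + 5)\<close> only multiply linear
  pieces that vanish on span \<open>q + 2\<close>, so the two double knots determine all three
  polynomials.\<close>

lemma quadratic_piece_double_knots:
  assumes "T ! (q + 1) = x" "T ! (q + 2) = x" "T ! (q + 3) = x + h" "T ! (q + 4) = x + h" "h > 0"
  shows "bspline_piece T (q + 2) 2 q (x + h * u) = (1 - u)\<^sup>2"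
    and "bspline_piece T (q + 2) 2 (q + 1) (x + h * u) = 2 * u * (1 - u)"
    and "bspline_piece T (q + 2) 2 (q + 2) (x + h * u) = u\<^sup>2"
  using assms by (simp_all add: eval_nat_numeral) (simp_all add: field_simps)

section \<open>Clamped knot lists and gluing of derivatives\<close>

lemma length_concat_map_replicate:
  "length (concat (map (\<lambda>x. replicate b (f x)) xs)) = b * length xs"
  by (induction xs) auto

lemma nth_concat_map_replicate:
  assumes "i < b * length xs"
  shows "concat (map (\<lambda>x. replicate b (f x)) xs) ! i = f (xs ! (i div b))"
  using assms
proof (induction xs arbitrary: i)
  case (Cons x xs)
  show ?case
  proof (cases "i < b")
    case False
    have "b > 0" using Cons.prems by (cases "b = 0") auto
    with False have "i div b = Suc ((i - b) div b)" by (simp add: le_div_geq)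
    with False Cons show ?thesis by (simp add: nth_append)
  qed (simp add: nth_append)
qed simp

lemma length_clamped_knots: "length (clamped_knots t m a b) = 2 * a + b * (m - 1)"
  by (simp add: clamped_knots_def length_concat_map_replicate numeral_2_eq_2 del: upt_Suc)

lemma last_clamped_knots: "a > 0 \<Longrightarrow> last (clamped_knots t m a b) = t (m + 1)"
  by (simp add: clamped_knots_def)

text \<open>After the first \<open>a\<close> entries, every block of \<open>b\<close> positions
  advances the breakpoint by one; the cap \<open>m + 1\<close> absorbs the closing copies.\<close>

lemma nth_clamped_knots:
  assumes "m \<ge> 1" "b > 0" "i < 2 * a + b * (m - 1)"
  shows "clamped_knots t m a b ! i = t (if i < a then 1 else min (2 + (i - a) div b) (m + 1))"
proof -
  consider "i < a" | "a \<le> i" "i - a < b * (m - 1)" | "a \<le> i" "b * (m - 1) \<le> i - a"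
    by linarith
  then show ?thesis
  proof cases
    case 2
    then have *: "(i - a) div b < m - 1" using assms
      by (simp add: less_mult_imp_div_less mult.commute)
    have "concat (map (\<lambda>k. replicate b (t k)) [2..<m + 1]) ! (i - a) = t ([2..<m + 1] ! ((i - a) div b))"
      using 2 by (intro nth_concat_map_replicate) (simp add: numeral_2_eq_2 del: upt_Suc)
    also have "\<dots> = t (2 + (i - a) div b)" using * by (subst nth_upt) auto
    finally show ?thesis using 2 *
      by (simp add: clamped_knots_def nth_append length_concat_map_replicate numeral_2_eq_2 del: upt_Suc)
  next
    case 3
    then have "m - 1 \<le> (i - a) div b" using assms
      by (simp add: less_eq_div_iff_mult_less_eq mult.commute)
    then have "min (2 + (i - a) div b) (m + 1) = m + 1" by simp
    with 3 assms show ?thesis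
      by (simp add: clamped_knots_def nth_append length_concat_map_replicate numeral_2_eq_2 del: upt_Suc)
  qed (simp add: clamped_knots_def nth_append)
qed

text \<open>Away from \<open>b\<close> the filter within \<open>{a..c}\<close> is that of one half;
  at \<open>b\<close> it is the supremum of the two one-sided filters.\<close>

lemma has_vector_derivative_glue:
  fixes f :: "real \<Rightarrow> 'a::real_normed_vector"
  assumes "\<And>x. x \<in> {a..b} \<Longrightarrow> (f has_vector_derivative g x) (at x within {a..b})"
    and "\<And>x. x \<in> {b..c} \<Longrightarrow> (f has_vector_derivative g x) (at x within {b..c})"
    and "a \<le> b" "b \<le> c" "x \<in> {a..c}"
  shows "(f has_vector_derivative g x) (at x within {a..c})"
proof -
  consider "x < b" | "x = b" | "b < x" by linarith
  then show ?thesis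
  proof cases
    case 1
    have "at x within {a..c} = at x within {a..b}"
      using 1 by (intro at_within_nhd[of _ "{..<b}"]) (use assms in auto)
    then show ?thesis using assms 1 by simp
  next
    case 3
    have "at x within {a..c} = at x within {b..c}"
      using 3 by (intro at_within_nhd[of _ "{b<..}"]) (use assms in auto)
    then show ?thesis using assms 3 by simp
  next
    case 2
    have "{a..c} = {a..b} \<union> {b..c}" using assms by auto
    then show ?thesis using assms(1)[of b] assms(2)[of b] assms(3,4) 2
      unfolding has_vector_derivative_def has_derivative_within
      by (simp add: at_within_union filterlim_sup)
  qed
qed

section \<open>Breakpoints and knot spans\<close>

locale breakpoints =
  fixes m :: nat and t :: "nat \<Rightarrow> real"
  assumes pos: "m \<ge> 1"
    and less_Suc: "\<And>k. k \<in> {1..m} \<Longrightarrow> t k < t (k + 1)"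
begin

text \<open>The zero gaps at both ends merge the boundary cases of the recursions into the general one.\<close>

definition gap :: "nat \<Rightarrow> real" where
  "gap k = (if k \<in> {1..m} then t (k + 1) - t k else 0)"

abbreviation local_par :: "nat \<Rightarrow> real \<Rightarrow> real" where
  "local_par k s \<equiv> (s - t (k + 1)) / gap (k + 1)"

lemma gap_pos: "k < m \<Longrightarrow> gap (Suc k) > 0"
  using less_Suc[of "Suc k"] by (simp add: gap_def)

lemma gap_nonneg: "gap k \<ge> 0"
  using less_Suc[of k] by (auto simp: gap_def)

lemma mono: "1 \<le> i \<Longrightarrow> i \<le> j \<Longrightarrow> j \<le> m + 1 \<Longrightarrow> t i \<le> t j"
proof (induction j)
  case (Suc j)
  then show ?case using less_Suc[of j] by (cases "i = Suc j") fastforce+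
qed simp

lemma sorted_clamped_knots: "b > 0 \<Longrightarrow> sorted (clamped_knots t m a b)"
  unfolding sorted_iff_nth_mono length_clamped_knots
  by (intro allI impI, subst (1 2) nth_clamped_knots)
    (use pos in \<open>auto intro!: mono min.mono div_le_mono\<close>)

text \<open>Spans are numbered from 0 and half-open, except that the last one contains its right
  end, where \<open>bspline\<close> is a left limit. Thus they partition the domain.\<close>

definition in_span :: "nat \<Rightarrow> real \<Rightarrow> bool" where
  "in_span k s \<longleftrightarrow> k < m \<and> t (k + 1) \<le> s \<and> (s < t (k + 2) \<or> s = t (m + 1) \<and> k + 1 = m)"

lemma in_span_exists:
  assumes "s \<in> {t 1..t (m + 1)}"
  obtains k where "in_span k s"
proof (cases "s = t (m + 1)")
  case True
  then have "in_span (m - 1) s" using pos mono[of m "m + 1"] by (auto simp: in_span_def)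
  then show ?thesis using that by blast
next
  case False
  \<comment> \<open>The first breakpoint beyond \<open>s\<close> is \<open>t (j + 1)\<close>, so
    \<open>s\<close> lies in span \<open>j - 1\<close>; \<open>j = 0\<close> would mean
    \<open>s < t 1\<close>.\<close>
  define j where "j = (LEAST j. s < t (j + 1))"
  have ex: "s < t (m + 1)" using False assms by auto
  have j: "s < t (j + 1)" "j \<le> m" unfolding j_def
    using LeastI[of "\<lambda>j. s < t (j + 1)", OF ex] Least_le[of "\<lambda>j. s < t (j + 1)", OF ex] by auto
  have "j \<noteq> 0" using j assms by (metis add_0 atLeastAtMost_iff linorder_not_less)
  moreover have "\<not> s < t j"
    using not_less_Least[of "j - 1" "\<lambda>j. s < t (j + 1)"] \<open>j \<noteq> 0\<close> by (simp add: j_def)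
  ultimately have "in_span (j - 1) s" using j by (auto simp: in_span_def numeral_2_eq_2)
  then show ?thesis using that by blast
qed

text \<open>The last copy of \<open>t (k + 1)\<close> is preceded by all other copies of the first
  \<open>k + 1\<close> breakpoints, which gives the zero-based position
  \<open>a + b * k - 1\<close>; the next entry is \<open>t (k + 2)\<close>.\<close>

lemma bspline_clamped_knots:
  assumes "in_span k s" "a \<ge> 1" "b \<ge> 1" "i + n + 1 < 2 * a + b * (m - 1)"
  shows "bspline (clamped_knots t m a b) n i s =
    bspline_piece (clamped_knots t m a b) (a + b * k - 1) n i s"
proof -
  have k: "k < m" "t (k + 1) \<le> s" "s < t (k + 2) \<or> s = t (m + 1) \<and> k + 1 = m"
    using assms(1) by (auto simp: in_span_def)
  obtain e where e: "m = k + 1 + e" using k(1) by (metis less_iff_Suc_add add.commute add.left_commute plus_1_eq_Suc)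
  have len: "a + b * k < 2 * a + b * (m - 1)" using assms by (simp add: e algebra_simps)
  have Suc_q: "Suc (a + b * k - 1) = a + b * k" using assms by simp
  have lo: "clamped_knots t m a b ! (a + b * k - 1) = t (k + 1)"
  proof (cases k)
    case 0
    then show ?thesis using assms len pos by (subst nth_clamped_knots) auto
  next
    case (Suc k')
    \<comment> \<open>The last position of block \<open>k'\<close>, which holds the copies of
      \<open>t (k' + 2)\<close>.\<close>
    have "(b * Suc k' - 1) div b = k'"
      using assms(3) by (intro div_nat_eqI) (auto simp: algebra_simps)
    moreover have "a + b * k - 1 - a = b * Suc k' - 1" "\<not> a + b * k - 1 < a" using Suc assms(3)
      by (auto simp: not_less Suc_le_eq)
    ultimately show ?thesis using Suc assms len pos k
      by (subst nth_clamped_knots) auto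
  qed
  have hi: "clamped_knots t m a b ! (a + b * k) = t (k + 2)"
    using assms len pos k by (subst nth_clamped_knots) auto
  show ?thesis
    by (rule bspline_eq_piece; (unfold Suc_q length_clamped_knots lo hi)?)
      (use assms k len less_Suc[of m] in \<open>auto simp: last_clamped_knots sorted_clamped_knots\<close>)
qed


section \<open>Explicit spline formulas on one span\<close>

lemma bspline_linear:
  fixes C :: "nat \<Rightarrow> 'a::real_vector"
  assumes "in_span k s"
  shows "(\<Sum>i=0..m. bspline (clamped_knots t m 2 1) 1 i s *\<^sub>R C i) =
    (1 - local_par k s) *\<^sub>R C k + local_par k s *\<^sub>R C (k + 1)"
proof -
  define T where "T = clamped_knots t m 2 1"
  define h u where "h = gap (k + 1)" and "u = local_par k s"
  have k: "k < m" using assms by (simp add: in_span_def)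
  have h: "h > 0" "t (k + 2) = t (k + 1) + h"
    using k gap_pos[of k] by (simp_all add: gap_def h_def)
  have T: "T ! Suc k = t (k + 1)" "T ! Suc (Suc k) = t (k + 1) + h"
    unfolding T_def h(2)[symmetric] using k pos by (subst nth_clamped_knots; force)+
  have s: "s = t (k + 1) + h * u" using h by (simp add: u_def h_def)
  let ?N = "\<lambda>i. bspline_piece T (k + 1) 1 i s"
  have N: "?N k = 1 - u" "?N (k + 1) = u"
    using h(1) by (simp_all add: T s) (simp add: field_simps)
  have "(\<Sum>i=0..m. bspline T 1 i s *\<^sub>R C i) = (\<Sum>i=0..m. ?N i *\<^sub>R C i)"
    unfolding T_def using assms by (intro sum.cong) (auto simp: bspline_clamped_knots)
  also have "\<dots> = (\<Sum>i\<in>{k, k + 1}. ?N i *\<^sub>R C i)"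
    using k by (intro sum.mono_neutral_right ballI scaleR_eq_0_iff[THEN iffD2, OF disjI1]
      bspline_piece_eq_0) auto
  also have "\<dots> = ?N k *\<^sub>R C k + ?N (k + 1) *\<^sub>R C (k + 1)"
    by (simp del: bspline_piece.simps)
  finally show ?thesis unfolding N by (simp add: T_def u_def)
qed

lemma bspline_quadratic:
  fixes C :: "nat \<Rightarrow> 'a::real_vector"
  assumes "in_span k s"
  shows "(\<Sum>i=0..2 * m. bspline (clamped_knots t m 3 2) 2 i s *\<^sub>R C i) =
    (1 - local_par k s)\<^sup>2 *\<^sub>R C (2 * k) + (2 * local_par k s * (1 - local_par k s)) *\<^sub>R C (2 * k + 1)
    + (local_par k s)\<^sup>2 *\<^sub>R C (2 * k + 2)"
proof -
  define T where "T = clamped_knots t m 3 2"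
  define q where "q = 2 * k"
  define h u where "h = gap (k + 1)" and "u = local_par k s"
  have k: "k < m" using assms by (simp add: in_span_def)
  have h: "h > 0" "t (k + 2) = t (k + 1) + h"
    using k gap_pos[of k] by (simp_all add: gap_def h_def)
  \<comment> \<open>In \<open>\<nu>\<close> these are two copies each of \<open>t (k + 1)\<close>
    and \<open>t (k + 2)\<close>, also at the ends, where the third copy falls outside these
    positions.\<close>
  have T: "T ! (q + 1) = t (k + 1)" "T ! (q + 2) = t (k + 1)"
    "T ! (q + 3) = t (k + 1) + h" "T ! (q + 4) = t (k + 1) + h"
    unfolding T_def q_def h(2)[symmetric] using k pos
    by (subst nth_clamped_knots; cases k; force)+
  have s: "s = t (k + 1) + h * u" using h by (simp add: u_def h_def)
  let ?N = "\<lambda>i. bspline_piece T (q + 2) 2 i s"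
  note N = quadratic_piece_double_knots[of T q "t (k + 1)" h u, folded s, OF T h(1)]
  have "(\<Sum>i=0..2 * m. bspline T 2 i s *\<^sub>R C i) = (\<Sum>i=0..2 * m. ?N i *\<^sub>R C i)"
    unfolding T_def q_def using assms pos by (intro sum.cong) (auto simp: bspline_clamped_knots)
  also have "\<dots> = (\<Sum>i\<in>{q, q + 1, q + 2}. ?N i *\<^sub>R C i)"
    using k unfolding q_def
    by (intro sum.mono_neutral_right ballI scaleR_eq_0_iff[THEN iffD2, OF disjI1]
      bspline_piece_eq_0) auto
  also have "\<dots> = ?N q *\<^sub>R C q + ?N (q + 1) *\<^sub>R C (q + 1) + ?N (q + 2) *\<^sub>R C (q + 2)"
    by (simp add: add.assoc del: bspline_piece.simps)
  finally show ?thesis unfolding N by (simp add: T_def u_def q_def)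
qed

text \<open>The differentiation formula for B-splines read backwards: each increment
  \<open>c (i + 1) - c i\<close> is \<open>C i\<close> times a third of the distance from knot
  \<open>i + 1\<close> to knot \<open>i + 4\<close> of \<open>\<rho>\<close>. It serves both the
  curve and its arc length.\<close>

definition cubic_coeffs :: "(nat \<Rightarrow> 'a::real_vector) \<Rightarrow> (nat \<Rightarrow> 'a) \<Rightarrow> bool" where
  "cubic_coeffs C c \<longleftrightarrow>
    (\<forall>k\<le>m. c (2 * k + 1) = c (2 * k) + ((gap k + gap (k + 1)) / 3) *\<^sub>R C (2 * k)) \<and>
    (\<forall>k<m. c (2 * k + 2) = c (2 * k + 1) + (gap (k + 1) / 3) *\<^sub>R C (2 * k + 1))"

text \<open>One recursion step turns the Bernstein quadratics into the four cubics alive on the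
  span. Expanding around \<open>c (2 * k + 1)\<close>, the neighbouring gaps in the basis functions
  cancel against those in the coefficient increments.\<close>

lemma bspline_cubic:
  fixes C c :: "nat \<Rightarrow> 'a::real_vector"
  assumes "in_span k s" "cubic_coeffs C c"
  shows "(\<Sum>i=0..2 * m + 1. bspline (clamped_knots t m 4 2) 3 i s *\<^sub>R c i) =
    c (2 * k + 1) - (gap (k + 1) / 3 * (1 - local_par k s) ^ 3) *\<^sub>R C (2 * k)
    + (gap (k + 1) / 3 * (3 * (local_par k s)\<^sup>2 - 2 * local_par k s ^ 3)) *\<^sub>R C (2 * k + 1)
    + (gap (k + 1) / 3 * local_par k s ^ 3) *\<^sub>R C (2 * k + 2)"
proof -
  define T where "T = clamped_knots t m 4 2"
  define q where "q = 2 * k"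
  define u where "u = local_par k s"
  define a h b where "a = gap k" and "h = gap (k + 1)" and "b = gap (k + 2)"
  have k: "k < m" using assms by (simp add: in_span_def)
  have abh: "a \<ge> 0" "b \<ge> 0" "h > 0"
    using gap_nonneg gap_pos[of k] k by (auto simp: a_def b_def h_def)
  have t2: "t (k + 2) = t (k + 1) + h" using k by (simp add: h_def gap_def)
  \<comment> \<open>The knot before the double knot is \<open>t k\<close>, or another copy of
    \<open>t 1\<close> if \<open>k = 0\<close>; with \<open>gap 0 = 0\<close> both are
    \<open>t (k + 1) - a\<close>. Position \<open>q + 6\<close> below is the mirror image.\<close>
  have "(if 2 * k + 1 < 4 then 1 else min (2 + (2 * k + 1 - 4) div 2) (m + 1)) =
      (if k = 0 then 1 else k)"
    using k unfolding min_def by presburger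
  then have "T ! (q + 1) = t (if k = 0 then 1 else k)"
    unfolding T_def q_def using k pos by (subst nth_clamped_knots) auto
  then have T1: "T ! (q + 1) = t (k + 1) - a" using k by (cases "k = 0") (auto simp: a_def gap_def)
  have T: "T ! (q + 2) = t (k + 1)" "T ! (q + 3) = t (k + 1)"
    "T ! (q + 4) = t (k + 1) + h" "T ! (q + 5) = t (k + 1) + h"
    unfolding T_def q_def t2[symmetric] using k pos
    by (subst nth_clamped_knots; cases k; force)+
  have "min (2 + (2 * k + 6 - 4) div 2) (m + 1) = (if k + 1 = m then m + 1 else k + 3)"
    using k unfolding min_def by presburger
  then have "T ! (q + 6) = t (if k + 1 = m then m + 1 else k + 3)"
    unfolding T_def q_def using k pos by (subst nth_clamped_knots) auto
  then have T6: "T ! (q + 6) = t (k + 1) + h + b" unfolding t2[symmetric] using k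
    by (cases "k + 1 = m") (auto simp: b_def gap_def eval_nat_numeral)
  have s: "s = t (k + 1) + h * u" using abh by (simp add: u_def h_def)
  let ?M = "\<lambda>i. bspline_piece T (q + 3) 2 i s" and ?N = "\<lambda>i. bspline_piece T (q + 3) 3 i s"
  have e: "q + 1 + 1 = q + 2" "q + 1 + 2 = q + 3" "q + 1 + 3 = q + 4" "q + 1 + 4 = q + 5"
    "q + 2 + 1 = q + 3" "q + 2 + 3 = q + 5" "q + 2 + 4 = q + 6" "q + 3 + 1 = q + 4"
    "q + 3 + 3 = q + 6"
    by simp_all
  \<comment> \<open>Compared with \<open>\<nu>\<close>, \<open>\<rho>\<close> has one more knot in
    front, so the Bernstein quadratics start at index \<open>q + 1\<close>.\<close>
  have M: "?M q = 0" "?M (q + 1) = (1 - u)\<^sup>2" "?M (q + 2) = 2 * u * (1 - u)" "?M (q + 3) = u\<^sup>2"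
    "?M (q + 4) = 0"
    using quadratic_piece_double_knots[of T "q + 1" "t (k + 1)" h u, unfolded e, OF T abh(3), folded s]
    by (simp_all only:) (simp_all add: bspline_piece_eq_0)
  have rec: "?N i = (s - T ! i) / (T ! (i + 3) - T ! i) * ?M i
      + (T ! (i + 4) - s) / (T ! (i + 4) - T ! (i + 1)) * ?M (i + 1)" for i
  proof -
    have *: "Suc 2 = 3" "i + 3 + 1 = i + 4" by simp_all
    show ?thesis using bspline_piece.simps(2)[of T "q + 3" 2 i s] unfolding * .
  qed
  \<comment> \<open>Only through these two ratios do the neighbouring gaps enter the cubics.\<close>
  define \<alpha> \<beta> where "\<alpha> = h / (h + a)" and "\<beta> = h / (h + b)"
  have N0: "?N q = \<alpha> * (1 - u) ^ 3"
  proof -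
    have "?N q = (h - h * u) / (h + a) * (1 - u)\<^sup>2" by (simp only: rec M T1 T) (simp add: s)
    also have "(h - h * u) / (h + a) = \<alpha> * (1 - u)" by (simp add: \<alpha>_def algebra_simps)
    finally show ?thesis by (simp add: eval_nat_numeral)
  qed
  have N1: "?N (q + 1) = (1 - \<alpha> * (1 - u)) * (1 - u)\<^sup>2 + (1 - u) * (2 * u * (1 - u))"
  proof -
    have "?N (q + 1) = (h * u + a) / (h + a) * (1 - u)\<^sup>2 + (h - h * u) / h * (2 * u * (1 - u))"
      by (simp only: rec[of "q + 1", unfolded e] M T1 T) (simp add: s)
    also have "(h * u + a) / (h + a) = 1 - \<alpha> * (1 - u)" using abh by (simp add: \<alpha>_def field_simps)
    also have "(h - h * u) / h = 1 - u" using abh by (simp add: field_simps)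
    finally show ?thesis .
  qed
  have N2: "?N (q + 2) = u * (2 * u * (1 - u)) + (1 - \<beta> * u) * u\<^sup>2"
  proof -
    have "?N (q + 2) = h * u / h * (2 * u * (1 - u)) + (h + b - h * u) / (h + b) * u\<^sup>2"
      by (simp only: rec[of "q + 2", unfolded e] M T T6) (simp add: s)
    also have "(h + b - h * u) / (h + b) = 1 - \<beta> * u" using abh by (simp add: \<beta>_def field_simps)
    also have "h * u / h = u" using abh by simp
    finally show ?thesis .
  qed
  have N3: "?N (q + 3) = \<beta> * u ^ 3"
    by (simp only: rec[of "q + 3", unfolded e] M T T6) (simp add: s \<beta>_def eval_nat_numeral)
  \<comment> \<open>The ratio drops out of the sum of the two left cubics, and likewise of the two
    right ones; all four add up to 1.\<close>
  have *: "?N (q + 1) = 1 - 3 * u\<^sup>2 + 2 * u ^ 3 - ?N q"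
    unfolding N0 N1 by (simp add: eval_nat_numeral algebra_simps)
  have **: "?N (q + 2) = 3 * u\<^sup>2 - 2 * u ^ 3 - ?N (q + 3)"
    unfolding N2 N3 by (simp add: eval_nat_numeral algebra_simps)
  have \<alpha>\<beta>: "\<alpha> * (a + h) = h" "\<beta> * (h + b) = h" 
    using abh by (simp_all add: \<alpha>_def \<beta>_def add.commute)
  have "?N q * ((a + h) / 3) = \<alpha> * (a + h) / 3 * (1 - u) ^ 3"
    "?N (q + 3) * ((h + b) / 3) = \<beta> * (h + b) / 3 * u ^ 3"
    unfolding N0 N3 by (simp_all add: mult_ac)
  note 0 = this[unfolded \<alpha>\<beta>]
  have c: "c (q + 1) = c q + ((a + h) / 3) *\<^sub>R C q" "c (q + 2) = c (q + 1) + (h / 3) *\<^sub>R C (q + 1)"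
    "c (q + 3) = c (q + 2) + ((h + b) / 3) *\<^sub>R C (q + 2)"
  proof -
    show "c (q + 1) = c q + ((a + h) / 3) *\<^sub>R C q" "c (q + 2) = c (q + 1) + (h / 3) *\<^sub>R C (q + 1)"
      using assms(2) k unfolding cubic_coeffs_def q_def a_def h_def by auto
    \<comment> \<open>On the last span this is the closing increment, where
      \<open>gap (k + 2) = 0\<close>.\<close>
    have "c (2 * (k + 1) + 1) = c (2 * (k + 1)) + ((gap (k + 1) + gap (k + 1 + 1)) / 3) *\<^sub>R C (2 * (k + 1))"
      using assms(2) k unfolding cubic_coeffs_def by (metis Suc_leI Suc_eq_plus1)
    then show "c (q + 3) = c (q + 2) + ((h + b) / 3) *\<^sub>R C (q + 2)"
      by (simp add: q_def h_def b_def eval_nat_numeral)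
  qed
  have "(\<Sum>i=0..2 * m + 1. bspline T 3 i s *\<^sub>R c i) = (\<Sum>i=0..2 * m + 1. ?N i *\<^sub>R c i)"
    unfolding T_def q_def using assms(1) pos
    by (intro sum.cong) (auto simp: bspline_clamped_knots add.commute)
  also have "\<dots> = (\<Sum>i\<in>{q, q + 1, q + 2, q + 3}. ?N i *\<^sub>R c i)"
    using k unfolding q_def by (intro sum.mono_neutral_right ballI scaleR_eq_0_iff[THEN iffD2, OF disjI1]
      bspline_piece_eq_0) auto
  also have "\<dots> = ?N q *\<^sub>R c q + ?N (q + 1) *\<^sub>R c (q + 1) + ?N (q + 2) *\<^sub>R c (q + 2) + ?N (q + 3) *\<^sub>R c (q + 3)"
    by (simp add: add.assoc del: bspline_piece.simps)
  also have "\<dots> = c (q + 1) - (?N q * ((a + h) / 3)) *\<^sub>R C q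
      + ((3 * u\<^sup>2 - 2 * u ^ 3) * (h / 3)) *\<^sub>R C (q + 1) + (?N (q + 3) * ((h + b) / 3)) *\<^sub>R C (q + 2)"
    unfolding * ** c by (simp only: scaleR_add_right scaleR_diff_right scaleR_add_left
      scaleR_diff_left scaleR_scaleR[symmetric] scaleR_one) (simp add: algebra_simps)
  finally show ?thesis unfolding 0 by (simp add: T_def q_def u_def h_def mult.commute)
qed

section \<open>Differentiating the cubic spline\<close>

lemma in_span_closed:
  assumes "k < m" "s \<in> {t (k + 1)..t (k + 2)}"
  shows "in_span k s \<or> in_span (Suc k) s \<and> s = t (k + 2)"
proof (cases "k + 1 = m")
  case True
  then show ?thesis using assms by (auto simp: in_span_def numeral_2_eq_2)
next
  case False
  then show ?thesis using assms less_Suc[of "k + 2"] by (auto simp: in_span_def eval_nat_numeral)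
qed

lemma local_par_end: "k < m \<Longrightarrow> local_par k (t (k + 2)) = 1"
  using gap_pos[of k] by (auto simp: gap_def)

text \<open>At the right end the parameter is 1 here and 0 in the next span; both formulas give
  \<open>C (2 * k + 2)\<close>. Closed spans are needed for one-sided derivatives.\<close>

lemma bspline_quadratic_closed:
  fixes C :: "nat \<Rightarrow> 'a::real_vector"
  assumes "k < m" "s \<in> {t (k + 1)..t (k + 2)}"
  shows "(\<Sum>i=0..2 * m. bspline (clamped_knots t m 3 2) 2 i s *\<^sub>R C i) =
    (1 - local_par k s)\<^sup>2 *\<^sub>R C (2 * k) + (2 * local_par k s * (1 - local_par k s)) *\<^sub>R C (2 * k + 1)
    + (local_par k s)\<^sup>2 *\<^sub>R C (2 * k + 2)"
  using in_span_closed[OF assms]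
proof
  assume s: "in_span (Suc k) s \<and> s = t (k + 2)"
  show ?thesis
    using s local_par_end[OF assms(1)] by (subst bspline_quadratic[of "Suc k"]) auto
qed (rule bspline_quadratic)

text \<open>At a shared breakpoint the two formulas agree by the two increments leading from
  \<open>c (2 * k + 1)\<close> to \<open>c (2 * k + 3)\<close>.\<close>

lemma bspline_cubic_closed:
  fixes C c :: "nat \<Rightarrow> 'a::real_vector"
  assumes "k < m" "s \<in> {t (k + 1)..t (k + 2)}" "cubic_coeffs C c"
  shows "(\<Sum>i=0..2 * m + 1. bspline (clamped_knots t m 4 2) 3 i s *\<^sub>R c i) =
    c (2 * k + 1) - (gap (k + 1) / 3 * (1 - local_par k s) ^ 3) *\<^sub>R C (2 * k)
    + (gap (k + 1) / 3 * (3 * (local_par k s)\<^sup>2 - 2 * local_par k s ^ 3)) *\<^sub>R C (2 * k + 1)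
    + (gap (k + 1) / 3 * local_par k s ^ 3) *\<^sub>R C (2 * k + 2)"
  using in_span_closed[OF assms(1,2)]
proof
  assume s: "in_span (Suc k) s \<and> s = t (k + 2)"
  have "c (2 * (k + 1) + 1) = c (2 * (k + 1)) + ((gap (k + 1) + gap (k + 1 + 1)) / 3) *\<^sub>R C (2 * (k + 1))"
    "c (2 * k + 2) = c (2 * k + 1) + (gap (k + 1) / 3) *\<^sub>R C (2 * k + 1)"
    using assms(1,3) unfolding cubic_coeffs_def by (metis Suc_leI Suc_eq_plus1, blast)
  then have "c (Suc (Suc (Suc (2 * k)))) = c (Suc (2 * k)) + (gap (Suc k) / 3) *\<^sub>R C (Suc (2 * k))
     + ((gap (Suc k) + gap (Suc (Suc k))) / 3) *\<^sub>R C (Suc (Suc (2 * k)))"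
    by simp
  then show ?thesis
    using s local_par_end[OF assms(1)] 
    by (subst bspline_cubic[of "Suc k" _ C]) (auto simp: assms(3) add_divide_distrib scaleR_add_left)
qed (rule bspline_cubic[OF _ assms(3)])

lemma cubic_bspline_has_vector_derivative:
  fixes C c :: "nat \<Rightarrow> 'a::real_normed_vector"
  assumes "cubic_coeffs C c" "s \<in> {t 1..t (m + 1)}"
  shows "((\<lambda>s. \<Sum>i=0..2 * m + 1. bspline (clamped_knots t m 4 2) 3 i s *\<^sub>R c i) has_vector_derivative
    (\<Sum>i=0..2 * m. bspline (clamped_knots t m 3 2) 2 i s *\<^sub>R C i)) (at s within {t 1..t (m + 1)})"
proof -
  define R where "R = (\<lambda>s. \<Sum>i=0..2 * m + 1. bspline (clamped_knots t m 4 2) 3 i s *\<^sub>R c i)"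
  define w where "w = (\<lambda>s. \<Sum>i=0..2 * m. bspline (clamped_knots t m 3 2) 2 i s *\<^sub>R C i)"
  have local: "(R has_vector_derivative w s) (at s within {t (k + 1)..t (k + 2)})"
    if k: "k < m" and s: "s \<in> {t (k + 1)..t (k + 2)}" for k s
  proof -
    define h where "h = gap (k + 1)"
    have h: "h > 0" using gap_pos k by (simp add: h_def)
    define u where "u = (\<lambda>s. (s - t (k + 1)) / h)"
    have u: "(u has_field_derivative 1 / h) (at s within A)" for s A
      unfolding u_def using h by (auto intro!: derivative_eq_intros)
    let ?F = "at s within {t (k + 1)..t (k + 2)}"
    \<comment> \<open>The weights integrate the Bernstein quadratics; the first one enters
      \<open>P\<close> with a minus sign.\<close>
    have f: "((\<lambda>s. h / 3 * (1 - u s) ^ 3) has_field_derivative - (1 - u s)\<^sup>2) ?F"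
      "((\<lambda>s. h / 3 * (3 * (u s)\<^sup>2 - 2 * u s ^ 3)) has_field_derivative 2 * u s * (1 - u s)) ?F"
      "((\<lambda>s. h / 3 * u s ^ 3) has_field_derivative (u s)\<^sup>2) ?F"
      by (rule derivative_eq_intros u refl | use h in \<open>simp add: field_simps power2_eq_square\<close>)+
    define P where "P = (\<lambda>s. c (2 * k + 1) - (h / 3 * (1 - u s) ^ 3) *\<^sub>R C (2 * k)
        + (h / 3 * (3 * (u s)\<^sup>2 - 2 * u s ^ 3)) *\<^sub>R C (2 * k + 1)
        + (h / 3 * u s ^ 3) *\<^sub>R C (2 * k + 2))"
    have "(P has_vector_derivative
        (0 - (- (1 - u s)\<^sup>2) *\<^sub>R C (2 * k) + (2 * u s * (1 - u s)) *\<^sub>R C (2 * k + 1)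
          + (u s)\<^sup>2 *\<^sub>R C (2 * k + 2))) ?F"
      unfolding P_def
      by (intro has_vector_derivative_add has_vector_derivative_diff has_vector_derivative_const)
        (use f[THEN has_vector_derivative_scaleR, OF has_vector_derivative_const] in simp_all)
    also have "0 - (- (1 - u s)\<^sup>2) *\<^sub>R C (2 * k) + (2 * u s * (1 - u s)) *\<^sub>R C (2 * k + 1)
          + (u s)\<^sup>2 *\<^sub>R C (2 * k + 2) = w s"
      unfolding w_def u_def h_def by (subst bspline_quadratic_closed[OF k s]) simp
    finally show ?thesis
    proof (rule has_vector_derivative_transform[OF s, rotated])
      fix x assume "x \<in> {t (k + 1)..t (k + 2)}"
      then show "R x = P x"
        unfolding R_def P_def u_def h_def by (rule bspline_cubic_closed[OF k _ assms(1)])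
    qed
  qed
  \<comment> \<open>Spans are attached from left to right. The one-sided derivatives at a breakpoint
    agree because both are the value of \<open>w\<close> there.\<close>
  have "\<forall>s\<in>{t 1..t (n + 1)}. (R has_vector_derivative w s) (at s within {t 1..t (n + 1)})"
    if "1 \<le> n" "n \<le> m" for n
    using that
  proof (induction n rule: dec_induct)
    case base
    then show ?case using local[of 0] by (auto simp: numeral_2_eq_2)
  next
    case (step n)
    have *: "t (n + 1) \<le> t (Suc n + 1)" "t 1 \<le> t (n + 1)"
      using step.prems by (auto intro!: mono)
    show ?case
      using step local[of n]
      by (intro ballI has_vector_derivative_glue[OF _ _ *(2) *(1)]) auto
  qed
  from this[of m] show ?thesis using pos assms(2) by (simp add: R_def w_def)
qed

section \<open>End values and existence of coefficients\<close>

lemma cubic_bspline_start: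
  assumes "cubic_coeffs C c"
  shows "(\<Sum>i=0..2 * m + 1. bspline (clamped_knots t m 4 2) 3 i (t 1) *\<^sub>R c i) = c 0"
proof -
  have "in_span 0 (t 1)" using pos less_Suc[of 1] by (auto simp: in_span_def numeral_2_eq_2)
  \<comment> \<open>As \<open>gap 0 = 0\<close>, this increment is exactly what the span formula
    subtracts at parameter 0.\<close>
  moreover have "c 1 = c 0 + (gap 1 / 3) *\<^sub>R C 0"
    using assms by (auto simp: cubic_coeffs_def gap_def dest!: spec[of _ 0])
  ultimately show ?thesis by (subst bspline_cubic[OF _ assms]) auto
qed

lemma cubic_bspline_end:
  assumes "cubic_coeffs C c"
  shows "(\<Sum>i=0..2 * m + 1. bspline (clamped_knots t m 4 2) 3 i (t (m + 1)) *\<^sub>R c i) = c (2 * m + 1)"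
proof -
  obtain k where k: "m = Suc k" using pos by (cases m) auto
  have "in_span k (t (m + 1))" using mono[of m "m + 1"] k pos unfolding in_span_def by simp
  moreover have "c (2 * m + 1) = c (2 * m) + (gap m / 3) *\<^sub>R C (2 * m)"
    using assms by (auto simp: cubic_coeffs_def gap_def dest!: spec[of _ m])
  moreover have "c (2 * k + 2) = c (2 * k + 1) + (gap (k + 1) / 3) *\<^sub>R C (2 * k + 1)"
    using assms lessI[of k] unfolding cubic_coeffs_def k[symmetric] by blast
  ultimately show ?thesis using local_par_end[of k]
    by (subst bspline_cubic[OF _ assms]) (auto simp: k)
qed

lemma cubic_coeffs_exist: "\<exists>c. c 0 = x \<and> cubic_coeffs C c"
proof -
  \<comment> \<open>The increment from coefficient \<open>i\<close> to \<open>i + 1\<close>, with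
    even and odd indices merged; \<open>x\<close> is the constant of integration.\<close>
  define \<delta> where "\<delta> i = (if even i then ((gap (i div 2) + gap (i div 2 + 1)) / 3) *\<^sub>R C i
    else (gap (i div 2 + 1) / 3) *\<^sub>R C i)" for i
  have "cubic_coeffs C (\<lambda>n. x + (\<Sum>i<n. \<delta> i))"
    by (simp add: cubic_coeffs_def \<delta>_def)
  then show ?thesis by (intro exI[of _ "\<lambda>n. x + (\<Sum>i<n. \<delta> i)"]) simp
qed

text \<open>Splits the uniform recursion into the cases of the theorem: at \<open>k = 0\<close> and
  \<open>k = m\<close> one of the two gaps is zero.\<close>

lemma cubic_coeffs_iff:
  "cubic_coeffs C c \<longleftrightarrow>
    c 1 = c 0 + (gap 1 / 3) *\<^sub>R C 0
    \<and> (\<forall>i<m. c (2 * i + 2) = c (2 * i + 1) + (gap (i + 1) / 3) *\<^sub>R C (2 * i + 1))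
    \<and> (\<forall>i. i + 1 < m \<longrightarrow>
          c (2 * i + 3) = c (2 * i + 2) + ((gap (i + 1) + gap (i + 2)) / 3) *\<^sub>R C (2 * i + 2))
    \<and> c (2 * m + 1) = c (2 * m) + (gap m / 3) *\<^sub>R C (2 * m)"
  (is "_ \<longleftrightarrow> ?R")
proof
  assume L: "cubic_coeffs C c"
  then have odd: "c (2 * k + 1) = c (2 * k) + ((gap k + gap (k + 1)) / 3) *\<^sub>R C (2 * k)" if "k \<le> m" for k
    using that unfolding cubic_coeffs_def by blast
  have "gap 0 = 0" "gap (m + 1) = 0" by (simp_all add: gap_def)
  moreover have "c (2 * i + 3) = c (2 * i + 2) + ((gap (i + 1) + gap (i + 2)) / 3) *\<^sub>R C (2 * i + 2)"
    if "i + 1 < m" for i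
    using odd[of "i + 1"] that by (simp add: eval_nat_numeral)
  ultimately show ?R using L odd[of 0] odd[of m] unfolding cubic_coeffs_def by simp
next
  assume R: ?R
  have gap: "gap 0 = 0" "gap (m + 1) = 0" by (simp_all add: gap_def)
  have "c (2 * k + 1) = c (2 * k) + ((gap k + gap (k + 1)) / 3) *\<^sub>R C (2 * k)" if "k \<le> m" for k
  proof -
    consider "k = 0" | i where "k = i + 1" "i + 1 < m" | "k = m"
      using \<open>k \<le> m\<close> by (cases k) force+
    then show ?thesis
    proof cases
      case (2 i)
      then have "c (2 * i + 3) = c (2 * i + 2) + ((gap (i + 1) + gap (i + 2)) / 3) *\<^sub>R C (2 * i + 2)"
        using R by blast
      then show ?thesis by (simp add: 2 eval_nat_numeral)
    qed (use R gap in simp_all)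
  qed
  with R show "cubic_coeffs C c" unfolding cubic_coeffs_def by blast
qed

end

section \<open>Pythagorean-hodograph curves and arc length\<close>

theorem mainTheorem7:
  fixes m :: nat
    and t d :: "nat \<Rightarrow> real"
    and z p \<sigma> l :: "nat \<Rightarrow> complex"
    and zc :: "real \<Rightarrow> complex"
    and \<mu> \<nu> \<rho> :: "real list"
  assumes "m \<ge> 1"
    and "t 1 = 0"
    and "\<And>k. k \<in> {1..m} \<Longrightarrow> t k < t (k + 1)"
    and "\<And>k. k \<in> {1..m} \<Longrightarrow> d k = t (k + 1) - t k"
    and "\<mu> = clamped_knots t m 2 1"
    and "\<nu> = clamped_knots t m 3 2"
    and "\<rho> = clamped_knots t m 4 2"
    and "\<And>s. s \<in> {t 1..t (m + 1)} \<Longrightarrow> zc s = (\<Sum>i=0..m. bspline \<mu> 1 i s *\<^sub>R z i)"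
    and "\<And>k. k \<le> m \<Longrightarrow> p (2 * k) = (z k)\<^sup>2"
    and "\<And>k. k < m \<Longrightarrow> p (2 * k + 1) = z k * z (k + 1)"
    and "\<And>k. k \<le> m \<Longrightarrow> \<sigma> (2 * k) = z k * cnj (z k)"
    and "\<And>k. k < m \<Longrightarrow> \<sigma> (2 * k + 1) = 1 / 2 * (z k * cnj (z (k + 1)) + z (k + 1) * cnj (z k))"
    and "l 0 = 0"
    and "l 1 = l 0 + of_real (d 1 / 3) * (z 0 * cnj (z 0))"
    and "\<And>i. i < m \<Longrightarrow> l (2 * i + 2) = l (2 * i + 1)
           + of_real (d (i + 1) / 6) * (z i * cnj (z (i + 1)) + z (i + 1) * cnj (z i))"
    and "\<And>i. i + 1 < m \<Longrightarrow> l (2 * i + 3) = l (2 * i + 2)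
           + of_real ((d (i + 1) + d (i + 2)) / 3) * (z (i + 1) * cnj (z (i + 1)))"
    and "l (2 * m + 1) = l (2 * m) + of_real (d m / 3) * (z m * cnj (z m))"
  shows "(\<forall>s\<in>{t 1..t (m + 1)}. (zc s)\<^sup>2 = (\<Sum>k=0..2 * m. bspline \<nu> 2 k s *\<^sub>R p k))
    \<and> (\<forall>s\<in>{t 1..t (m + 1)}.
           complex_of_real ((norm (zc s))\<^sup>2) = (\<Sum>k=0..2 * m. bspline \<nu> 2 k s *\<^sub>R \<sigma> k))
    \<and> (\<forall>r :: real \<Rightarrow> complex.
           (\<forall>s\<in>{t 1..t (m + 1)}. (r has_vector_derivative (zc s)\<^sup>2) (at s within {t 1..t (m + 1)}))
           \<longleftrightarrow> (\<exists>c :: nat \<Rightarrow> complex.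
                  c 1 = c 0 + of_real (d 1 / 3) * (z 0)\<^sup>2
                \<and> (\<forall>i<m. c (2 * i + 2) = c (2 * i + 1) + of_real (d (i + 1) / 3) * (z i * z (i + 1)))
                \<and> (\<forall>i. i + 1 < m \<longrightarrow> c (2 * i + 3) = c (2 * i + 2)
                         + of_real ((d (i + 1) + d (i + 2)) / 3) * (z (i + 1))\<^sup>2)
                \<and> c (2 * m + 1) = c (2 * m) + of_real (d m / 3) * (z m)\<^sup>2
                \<and> (\<forall>s\<in>{t 1..t (m + 1)}. r s = (\<Sum>i=0..2 * m + 1. bspline \<rho> 3 i s *\<^sub>R c i))))
    \<and> (\<forall>r :: real \<Rightarrow> complex.
           (\<forall>s\<in>{t 1..t (m + 1)}. (r has_vector_derivative (zc s)\<^sup>2) (at s within {t 1..t (m + 1)}))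
           \<longrightarrow> (\<exists>L. has_arc_length r (t 1) (t (m + 1)) L \<and> complex_of_real L = l (2 * m + 1)))"
proof -
  interpret breakpoints m t using assms(1,3) by unfold_locales auto
  let ?I = "{t 1..t (m + 1)}"
  let ?Q = "\<lambda>C s. \<Sum>k=0..2 * m. bspline \<nu> 2 k s *\<^sub>R (C k :: complex)"
  let ?R = "\<lambda>c s. \<Sum>i=0..2 * m + 1. bspline \<rho> 3 i s *\<^sub>R (c i :: complex)"
  have d: "d k = gap k" if "k \<in> {1..m}" for k using assms(4)[OF that] that by (simp add: gap_def)
  have t1: "t 1 < t (m + 1)" using mono[of 1 m] less_Suc[of m] pos by auto
  have zc: "(zc s)\<^sup>2 = ?Q p s" "complex_of_real ((norm (zc s))\<^sup>2) = ?Q \<sigma> s" if s: "s \<in> ?I" for s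
  proof -
    obtain k where k: "in_span k s" using in_span_exists[OF s] .
    then have "k < m" by (simp add: in_span_def)
    define u where "u = local_par k s"
    have z: "zc s = (1 - of_real u) * z k + of_real u * z (k + 1)"
      using assms(8)[OF s] bspline_linear[OF k, of z] by (simp add: assms(5) u_def scaleR_conv_of_real)
    have p: "p (2 * k) = (z k)\<^sup>2" "p (2 * k + 1) = z k * z (k + 1)" "p (2 * k + 2) = (z (k + 1))\<^sup>2"
      using assms(9)[of k] assms(9)[of "k + 1"] assms(10)[of k] \<open>k < m\<close> by auto
    have \<sigma>: "\<sigma> (2 * k) = z k * cnj (z k)"
      "\<sigma> (2 * k + 1) = 1 / 2 * (z k * cnj (z (k + 1)) + z (k + 1) * cnj (z k))"
      "\<sigma> (2 * k + 2) = z (k + 1) * cnj (z (k + 1))"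
      using assms(11)[of k] assms(11)[of "k + 1"] assms(12)[of k] \<open>k < m\<close> by auto
    show "(zc s)\<^sup>2 = ?Q p s"
      unfolding assms(6) bspline_quadratic[OF k] u_def[symmetric] p z
      by (simp add: scaleR_conv_of_real power2_eq_square algebra_simps)
    show "complex_of_real ((norm (zc s))\<^sup>2) = ?Q \<sigma> s"
      unfolding assms(6) bspline_quadratic[OF k] u_def[symmetric] \<sigma> complex_norm_square z
      by (simp add: scaleR_conv_of_real power2_eq_square algebra_simps)
  qed
  have deriv: "(?R c has_vector_derivative ?Q C s) (at s within ?I)"
    if "cubic_coeffs C c" "s \<in> ?I" for C c s
    using cubic_bspline_has_vector_derivative[OF that] by (simp only: assms(6,7))
  have coeffs_p: "cubic_coeffs p c \<longleftrightarrow>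
      c 1 = c 0 + of_real (d 1 / 3) * (z 0)\<^sup>2
    \<and> (\<forall>i<m. c (2 * i + 2) = c (2 * i + 1) + of_real (d (i + 1) / 3) * (z i * z (i + 1)))
    \<and> (\<forall>i. i + 1 < m \<longrightarrow> c (2 * i + 3) = c (2 * i + 2)
             + of_real ((d (i + 1) + d (i + 2)) / 3) * (z (i + 1))\<^sup>2)
    \<and> c (2 * m + 1) = c (2 * m) + of_real (d m / 3) * (z m)\<^sup>2" for c
    unfolding cubic_coeffs_iff scaleR_conv_of_real
    using pos d assms(9)[of 0] assms(9)[of m] assms(9)[of "Suc _"] assms(10) by auto
  have coeffs_l: "cubic_coeffs \<sigma> l"
    unfolding cubic_coeffs_iff scaleR_conv_of_real
    using pos d assms(11)[of 0] assms(11)[of m] assms(11)[of "Suc _"] assms(12) assms(14-17) by auto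
  have primitive: "(\<forall>s\<in>?I. (r has_vector_derivative (zc s)\<^sup>2) (at s within ?I)) \<longleftrightarrow>
      (\<exists>c. cubic_coeffs p c \<and> (\<forall>s\<in>?I. r s = ?R c s))" for r :: "real \<Rightarrow> complex"
  proof safe
    fix c s assume c: "cubic_coeffs p c" "\<forall>s\<in>?I. r s = ?R c s" and s: "s \<in> ?I"
    show "(r has_vector_derivative (zc s)\<^sup>2) (at s within ?I)"
      by (rule has_vector_derivative_transform[OF s]) (use c s deriv[OF c(1) s] zc(1)[OF s] in auto)
  next
    assume r: "\<forall>s\<in>?I. (r has_vector_derivative (zc s)\<^sup>2) (at s within ?I)"
    \<comment> \<open>Starting at \<open>r (t 1)\<close> makes the spline agree with
      \<open>r\<close> at the left end, so their constant difference \<open>e\<close> is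
      zero.\<close>
    obtain c where c: "c 0 = r (t 1)" "cubic_coeffs p c" using cubic_coeffs_exist by blast
    have "((\<lambda>s. r s - ?R c s) has_vector_derivative 0) (at s within ?I)" if "s \<in> ?I" for s
      using has_vector_derivative_diff[OF r[rule_format, OF that] deriv[OF c(2) that]]
      by (simp only: zc(1)[OF that] diff_self)
    then obtain e where e: "\<And>s. s \<in> ?I \<Longrightarrow> r s - ?R c s = e"
      using has_vector_derivative_zero_constant[of ?I "\<lambda>s. r s - ?R c s"] by (auto simp only: convex_real_interval)
    have "r (t 1) - ?R c (t 1) = e" using e t1 by (simp only: atLeastAtMost_iff) simp
    then have "e = 0" using cubic_bspline_start[OF c(2)] by (simp only: assms(7) c(1)) simp
    then have "\<forall>s\<in>?I. r s = ?R c s" using e by (simp only: right_minus_eq) blast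
    with c show "\<exists>c. cubic_coeffs p c \<and> (\<forall>s\<in>?I. r s = ?R c s)" by blast
  qed
  have arc: "\<exists>L. has_arc_length r (t 1) (t (m + 1)) L \<and> complex_of_real L = l (2 * m + 1)"
    if r: "\<forall>s\<in>?I. (r has_vector_derivative (zc s)\<^sup>2) (at s within ?I)" for r
  proof -
    \<comment> \<open>The arc length coefficients \<open>l\<close> come from \<open>\<sigma>\<close>
      by the same recursion as the curve from \<open>p\<close>, so the same derivative rule
      applies.\<close>
    have "(?Q \<sigma> has_integral ?R l (t (m + 1)) - ?R l (t 1)) ?I"
      using t1 by (intro fundamental_theorem_of_calculus deriv coeffs_l) auto
    also have "?R l (t (m + 1)) - ?R l (t 1) = l (2 * m + 1)"
      unfolding assms(7) cubic_bspline_start[OF coeffs_l] cubic_bspline_end[OF coeffs_l]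
      by (simp add: assms(13))
    finally have I: "((\<lambda>s. complex_of_real ((norm (zc s))\<^sup>2)) has_integral l (2 * m + 1)) ?I"
      by (rule has_integral_eq[rotated]) (simp only: zc)
    have re: "((\<lambda>s. (norm (zc s))\<^sup>2) has_integral Re (l (2 * m + 1))) ?I"
      using has_integral_linear[OF I bounded_linear_Re] by (simp add: o_def)
    \<comment> \<open>The integrand is real, so \<open>l (2 * m + 1)\<close> is real too and its
      real part can serve as \<open>L\<close>.\<close>
    have "((\<lambda>s. 0) has_integral Im (l (2 * m + 1))) ?I"
      using has_integral_linear[OF I bounded_linear_Im] by (simp add: o_def)
    then have im: "Im (l (2 * m + 1)) = 0" using has_integral_unique has_integral_0 by blast
    \<comment> \<open>Derivatives within the interval are unique because
      \<open>t 1 < t (m + 1)\<close>.\<close>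
    have dr: "vector_derivative r (at s within ?I) = (zc s)\<^sup>2" if "s \<in> ?I" for s
      unfolding cbox_interval[symmetric]
      by (rule vector_derivative_within_cbox[OF t1]) (use r that in auto)
    have "has_arc_length r (t 1) (t (m + 1)) (Re (l (2 * m + 1)))"
      unfolding has_arc_length_def
      by (rule has_integral_eq[OF _ re]) (simp only: dr norm_power)
    with im show ?thesis by (auto intro!: exI[of _ "Re (l (2 * m + 1))"] simp: complex_eq_iff)
  qed
  show ?thesis
  proof (intro conjI ballI allI impI)
    show "(\<forall>s\<in>?I. (r has_vector_derivative (zc s)\<^sup>2) (at s within ?I)) \<longleftrightarrow>
      (\<exists>c. c 1 = c 0 + of_real (d 1 / 3) * (z 0)\<^sup>2
        \<and> (\<forall>i<m. c (2 * i + 2) = c (2 * i + 1) + of_real (d (i + 1) / 3) * (z i * z (i + 1)))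
        \<and> (\<forall>i. i + 1 < m \<longrightarrow> c (2 * i + 3) = c (2 * i + 2)
                 + of_real ((d (i + 1) + d (i + 2)) / 3) * (z (i + 1))\<^sup>2)
        \<and> c (2 * m + 1) = c (2 * m) + of_real (d m / 3) * (z m)\<^sup>2
        \<and> (\<forall>s\<in>?I. r s = ?R c s))" for r
      unfolding primitive coeffs_p conj_assoc ..
  qed (use zc arc in blast)+
qed

end
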